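(* Let $N\ge 1$ be an integer. (1) Let $P_{N+1}(x)$ be a monic real polynomial of degree $N+1$ with $N+1$ simple real zeros $x_0<x_1<\dots<x_N$, and let $P_N(x)=(N+1)^{-1}P_{N+1}'(x)$. Then the mirror-dual polynomials $P_n^*(x)$, $n=0,1,\dots,N$, associated with the pair $(P_{N+1},P_N)$ are of Legendre type on the grid $\{x_s\}$, i.e. $$\frac{1}{N+1}\sum_{s=0}^N P_n^*(x_s)P_m^*(x_s)=h_n^*\,\delta_{nm},\qquad n,m=0,1,\dots,N,$$ where $h_0^*=1$, $h_n^*=u_1^*u_2^*\cdots u_n^*$. (2) Conversely, let $x_0<x_1<\dots<x_N$ be real numbers and let $P_n^*(x)$, $n=0,1,\dots,N$, be monic polynomials with $\deg P_n^*=n$ that are orthogonal on the points $x_s$ with the constant weights $w_s^*=(N+1)^{-1}$, $s=0,\dots,N$. Then this system corresponds to a Sturmian pair: the $P_n^*$ are the mirror-dual polynomials associated with the pair $P_{N+1}(x)=\prod_{s=0}^N(x-x_s)$, $P_N(x)=(N+1)^{-1}P_{N+1}'(x)$.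
   Context: Let $P_{N+1}$ be a monic polynomial with simple real zeros $x_0<\dots<x_N$ and $P_N$ a monic polynomial of degree $N$ with simple real zeros interlacing those of $P_{N+1}$. The Euclidean algorithm produces uniquely monic polynomials $P_{N-1},P_{N-2},\dots,P_0=1$ ($\deg P_n=n$), real numbers $b_n$ and positive numbers $u_n>0$ such that $$P_{n+1}(x)=(x-b_n)P_n(x)-u_nP_{n-1}(x),\quad n=1,2,\dots,N,\qquad P_1(x)=x-b_0 .$$ The mirror-dual coefficients are $b_n^*=b_{N-n}$ ($0\le n\le N$) and $u_n^*=u_{N+1-n}$ ($1\le n\le N$). The mirror-dual polynomials $P_n^*$ associated with the pair $(P_{N+1},P_N)$ are defined by $P_0^*=1$, $P_1^*(x)=x-b_0^*=x-b_N$, and $P_{n+1}^*(x)=(x-b_n^* )P_n^*(x)-u_n^*P_{n-1}^*(x)$. The pair $(P_{N+1},P_N)$ is called a Sturmian pair if $P_N(x)=(N+1)^{-1}P_{N+1}'(x)$ (the zeros of $P_{N+1}'$ interlace those of $P_{N+1}$ automatically). A finite system of orthogonal polynomials on $N+1$ points is of Legendre type if it is orthogonal with respect to constant weights equal to $(N+1)^{-1}$. *)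

theory Defs
  imports Complex_Main "HOL-Computational_Algebra.Polynomial"
begin

text \<open>
  The remainder sequence of a pair \<open>(p, q)\<close>, each remainder being made monic.
  For a pair \<open>(P_{N+1}, P_N)\<close>, entry number \<open>k\<close> is \<open>P_{N+1-k}\<close>.
\<close>

fun euclid_seq :: "real poly \<Rightarrow> real poly \<Rightarrow> nat \<Rightarrow> real poly" where
  "euclid_seq p q 0 = p"
| "euclid_seq p q (Suc 0) = q"
| "euclid_seq p q (Suc (Suc k)) =
     (let r = euclid_seq p q k mod euclid_seq p q (Suc k)
      in smult (inverse (lead_coeff r)) r)"

definition euclid_poly :: "nat \<Rightarrow> real poly \<Rightarrow> real poly \<Rightarrow> nat \<Rightarrow> real poly" where
  "euclid_poly N p q n = euclid_seq p q (N + 1 - n)"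

text \<open>
  Since \<open>P_{n+1} = (x - b_n) P_n - u_n P_{n-1}\<close> is the division of \<open>P_{n+1}\<close> by \<open>P_n\<close>,
  the quotient is \<open>x - b_n\<close> and the remainder is \<open>- u_n P_{n-1}\<close> with \<open>P_{n-1}\<close> monic.
  For \<open>n = 0\<close> the quotient is \<open>P_1 = x - b_0\<close> itself.
\<close>

definition euclid_b :: "nat \<Rightarrow> real poly \<Rightarrow> real poly \<Rightarrow> nat \<Rightarrow> real" where
  "euclid_b N p q n = - coeff (euclid_poly N p q (n + 1) div euclid_poly N p q n) 0"

definition euclid_u :: "nat \<Rightarrow> real poly \<Rightarrow> real poly \<Rightarrow> nat \<Rightarrow> real" where
  "euclid_u N p q n = - lead_coeff (euclid_poly N p q (n + 1) mod euclid_poly N p q n)"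

definition mirror_b :: "nat \<Rightarrow> real poly \<Rightarrow> real poly \<Rightarrow> nat \<Rightarrow> real" where
  "mirror_b N p q n = euclid_b N p q (N - n)"

definition mirror_u :: "nat \<Rightarrow> real poly \<Rightarrow> real poly \<Rightarrow> nat \<Rightarrow> real" where
  "mirror_u N p q n = euclid_u N p q (N + 1 - n)"

fun three_term :: "(nat \<Rightarrow> real) \<Rightarrow> (nat \<Rightarrow> real) \<Rightarrow> nat \<Rightarrow> real poly" where
  "three_term b u 0 = 1"
| "three_term b u (Suc 0) = [:- b 0, 1:]"
| "three_term b u (Suc (Suc n)) =
     [:- b (Suc n), 1:] * three_term b u (Suc n) - smult (u (Suc n)) (three_term b u n)"

definition mirror_dual :: "nat \<Rightarrow> real poly \<Rightarrow> real poly \<Rightarrow> nat \<Rightarrow> real poly" where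
  "mirror_dual N p q = three_term (mirror_b N p q) (mirror_u N p q)"

definition interlacing_pair :: "nat \<Rightarrow> real poly \<Rightarrow> real poly \<Rightarrow> bool" where
  "interlacing_pair N p q \<longleftrightarrow>
     degree p = N + 1 \<and> lead_coeff p = 1 \<and> degree q = N \<and> lead_coeff q = 1 \<and>
     (\<exists>x y. (\<forall>s\<le>N. poly p (x s) = 0) \<and> (\<forall>s<N. poly q (y s) = 0) \<and>
            (\<forall>s<N. x s < y s \<and> y s < x (Suc s)))"


text \<open>
  The algorithm delivers the unique data with the stated properties: existence for every
  interlacing pair, and uniqueness.
\<close>

lemma poly_from_roots:
  fixes p :: "real poly" and x :: "nat \<Rightarrow> real"
  assumes "p \<noteq> 0" "degree p \<le> n" "inj_on x {..<n}" "\<forall>s<n. poly p (x s) = 0"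
  shows "p = smult (lead_coeff p) (\<Prod>s<n. [:- x s, 1:])" "degree p = n"
proof -
  have "\<exists>c. p = smult c (\<Prod>s<n. [:- x s, 1:]) \<and> c \<noteq> 0"
    using assms
  proof (induction n arbitrary: p)
    case 0
    then show ?case by (auto elim!: degree_eq_zeroE)
  next
    case (Suc n)
    from Suc.prems have "poly p (x n) = 0" by simp
    then obtain g where g: "p = [:- x n, 1:] * g" by (auto simp: poly_eq_0_iff_dvd elim: dvdE)
    with Suc.prems have g0: "g \<noteq> 0" by auto
    then have "degree p = Suc (degree g)" unfolding g by (subst degree_mult_eq) auto
    with Suc.prems have dg: "degree g \<le> n" by simp
    have inj: "inj_on x {..<n}" using Suc.prems(3) by (rule inj_on_subset) auto
    have "poly g (x s) = 0" if "s < n" for s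
    proof -
      have "poly p (x s) = 0" using Suc.prems that by simp
      moreover have "x s \<noteq> x n" using inj_onD[OF Suc.prems(3), of s n] that by auto
      ultimately show ?thesis by (simp add: g)
    qed
    with Suc.IH[OF g0 dg inj] obtain c where "g = smult c (\<Prod>s<n. [:- x s, 1:])" "c \<noteq> 0" by blast
    then show ?case by (intro exI[of _ c]) (simp add: g mult.commute)
  qed
  then obtain c where c: "p = smult c (\<Prod>s<n. [:- x s, 1:])" "c \<noteq> 0" by blast
  have d: "degree (\<Prod>s<n. [:- x s, 1:]) = n" by (subst degree_prod_eq_sum_degree) auto
  have "lead_coeff (\<Prod>s<n. [:- x s, 1:]) = 1" by (simp add: lead_coeff_prod)
  then have "lead_coeff (smult c (\<Prod>s<n. [:- x s, 1:])) = c"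
    by (simp only: lead_coeff_smult mult_1_right)
  then have "lead_coeff p = c" using c by simp
  then show "p = smult (lead_coeff p) (\<Prod>s<n. [:- x s, 1:])" using c by simp
  show "degree p = n" using c d by simp
qed

lemma prod_sign:
  fixes x :: "nat \<Rightarrow> real"
  assumes "\<And>s. s \<le> j \<Longrightarrow> x s < t" "\<And>s. j < s \<Longrightarrow> s < m \<Longrightarrow> t < x s" "j < m"
  shows "(- 1) ^ (m - Suc j) * (\<Prod>s<m. t - x s) > 0"
  using assms
proof (induction "m - Suc j" arbitrary: m)
  case 0
  then have "m = Suc j" by simp
  have "(\<Prod>s<m. t - x s) > 0" using 0(2) \<open>m = Suc j\<close> by (intro prod_pos) auto
  then show ?case using \<open>m = Suc j\<close> by simp
next
  case (Suc k)
  then obtain m' where m: "m = Suc m'" by (cases m) auto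
  with Suc have "(- 1) ^ (m' - Suc j) * (\<Prod>s<m'. t - x s) > 0" by auto
  moreover have "t < x m'" "m' > j" using Suc m by auto
  ultimately have "(x m' - t) * ((- 1) ^ (m' - Suc j) * (\<Prod>s<m'. t - x s)) > 0" by simp
  moreover have "m - Suc j = Suc (m' - Suc j)" using m \<open>m' > j\<close> by simp
  ultimately show ?case by (simp add: m algebra_simps)
qed

lemma interlacing_step:
  assumes "interlacing_pair (Suc n) p q"
  defines "r \<equiv> p mod q"
  defines "s \<equiv> smult (inverse (lead_coeff r)) r"
  shows "interlacing_pair n q s" "lead_coeff r < 0"
    "p div q = [:coeff (p div q) 0, 1:]"
proof -
  obtain x y where
    p: "degree p = n + 2" "lead_coeff p = 1" and q: "degree q = Suc n" "lead_coeff q = 1"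
    and px: "\<And>i. i \<le> Suc n \<Longrightarrow> poly p (x i) = 0"
    and qy: "\<And>i. i \<le> n \<Longrightarrow> poly q (y i) = 0"
    and xy: "\<And>i. i \<le> n \<Longrightarrow> x i < y i" and yx: "\<And>i. i \<le> n \<Longrightarrow> y i < x (Suc i)"
  proof -
    from assms(1) obtain x y where
      "\<forall>i\<le>Suc n. poly p (x i) = 0" "\<forall>i<Suc n. poly q (y i) = 0"
      "\<forall>i<Suc n. x i < y i \<and> y i < x (Suc i)"
      unfolding interlacing_pair_def by blast
    then show thesis
      using assms(1) unfolding interlacing_pair_def
      by (intro that[of x y]) (auto simp: less_Suc_eq_le)
  qed
  have xmono: "i < j \<Longrightarrow> j \<le> Suc n \<Longrightarrow> x i < x j" for i j
  proof (induction j)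
    case (Suc j)
    then show ?case using xy[of j] yx[of j] by (cases "i = j") auto
  qed simp
  have q0: "q \<noteq> 0" using q by auto
  have p0: "p \<noteq> 0" using p by auto
  have "inj_on x {..<n + 2}"
  proof (rule inj_onI)
    fix i j assume "i \<in> {..<n + 2}" "j \<in> {..<n + 2}" "x i = x j"
    then show "i = j" using xmono[of i j] xmono[of j i] by (cases i j rule: linorder_cases) auto
  qed
  then have pp: "p = (\<Prod>i<n + 2. [:- x i, 1:])"
    using poly_from_roots(1)[OF p0, of "n + 2" x] p px by simp
  have eq: "p = (p div q) * q + r" by (simp add: r_def)
  have ry: "poly r (y i) = poly p (y i)" if "i \<le> n" for i
    using arg_cong[OF eq, of "\<lambda>f. poly f (y i)"] qy[OF that] by simp
  have sgn: "(- 1) ^ (Suc n - i) * poly r (y i) > 0" if i: "i \<le> n" for i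
  proof -
    have "x k < y i" if "k \<le> i" for k
      using that i xmono[of k i] xy[of i] by (cases "k = i") auto
    moreover have "y i < x k" if "i < k" "k < n + 2" for k
      using that i xmono[of "Suc i" k] yx[of i] by (cases "k = Suc i") auto
    ultimately have "(- 1) ^ (n + 2 - Suc i) * (\<Prod>k<n + 2. y i - x k) > 0"
      using i by (intro prod_sign) auto
    moreover have "poly p (y i) = (\<Prod>k<n + 2. y i - x k)"
      by (subst pp) (simp add: poly_prod algebra_simps)
    ultimately show ?thesis using i by (simp add: ry)
  qed
  have "\<exists>z>y i. z < y (Suc i) \<and> poly r z = 0" if i: "i < n" for i
  proof -
    have lt: "y i < y (Suc i)" using yx[of i] xy[of "Suc i"] i by auto
    have "Suc n - i = Suc (Suc n - Suc i)" using i by simp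
    then have "(- 1) ^ (Suc n - Suc i) * poly r (y i) < 0"
      using sgn[of i] i by simp
    moreover have "(- 1) ^ (Suc n - Suc i) * poly r (y (Suc i)) > 0"
      using sgn[of "Suc i"] i by simp
    ultimately have "poly r (y i) * poly r (y (Suc i)) < 0"
      by (cases "even (Suc n - Suc i)") (auto simp: mult_less_0_iff)
    with poly_IVT[OF lt, of r] show ?thesis by auto
  qed
  then obtain z where z: "\<And>i. i < n \<Longrightarrow> y i < z i \<and> z i < y (Suc i) \<and> poly r (z i) = 0" by metis
  have zmono: "i < j \<Longrightarrow> j < n \<Longrightarrow> z i < z j" for i j
  proof (induction j)
    case (Suc j)
    then show ?case using z[of j] z[of "Suc j"] by (cases "i = j") auto
  qed simp
  have inj: "inj_on z {..<n}"
  proof (rule inj_onI)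
    fix i j assume "i \<in> {..<n}" "j \<in> {..<n}" "z i = z j"
    then show "i = j" using zmono[of i j] zmono[of j i] by (cases i j rule: linorder_cases) auto
  qed
  have rneg: "poly r (y n) < 0" using sgn[of n] by simp
  then have r0: "r \<noteq> 0" by auto
  then have "degree r < degree q" using degree_mod_less[OF q0, of p] by (auto simp: r_def)
  then have "degree r \<le> n" using q by simp
  then have rr: "r = smult (lead_coeff r) (\<Prod>i<n. [:- z i, 1:])" and dr: "degree r = n"
    using poly_from_roots[OF r0 _ inj] z by auto
  have "poly r (y n) = lead_coeff r * (\<Prod>i<n. y n - z i)"
    by (subst rr) (simp add: poly_prod)
  moreover have "(\<Prod>i<n. y n - z i) > 0"
  proof (rule prod_pos)
    fix i assume "i \<in> {..<n}"
    then have "i < n" by simp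
    then have "i = n - 1 \<or> i < n - 1" by linarith
    then have "z i \<le> z (n - 1)" using zmono[of i "n - 1"] \<open>i < n\<close> by fastforce
    moreover have "z (n - 1) < y n" using z[of "n - 1"] \<open>i < n\<close> by simp
    ultimately show "0 < y n - z i" by simp
  qed
  ultimately show l: "lead_coeff r < 0" using rneg by (simp add: mult_less_0_iff)
  have "degree s = n" "lead_coeff s = 1" using dr l r0 by (simp_all add: s_def)
  moreover have "\<forall>i<n. poly s (z i) = 0" using z by (simp add: s_def)
  ultimately show "interlacing_pair n q s"
    unfolding interlacing_pair_def using q qy z
    by (intro conjI exI[of _ y] exI[of _ z]) auto
  have dq0: "p div q \<noteq> 0"
  proof
    assume "p div q = 0"
    with eq have "p = r" by simp
    with dr p show False by simp
  qed
  have "degree (p div q * q) = degree p"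
  proof -
    have "p div q * q = p - r" using eq by (simp add: algebra_simps)
    moreover have "degree (p + - r) = degree p" using dr p by (intro degree_add_eq_left) simp
    ultimately show ?thesis by simp
  qed
  then have dd: "degree (p div q) = 1"
    using dq0 q0 p q by (simp add: degree_mult_eq)
  have "lead_coeff (p div q) = lead_coeff (p div q * q)" using q by (simp add: lead_coeff_mult)
  also have "\<dots> = coeff (p - r) (n + 2)"
    using eq \<open>degree (p div q * q) = degree p\<close> p by (metis add_diff_cancel_right')
  also have "\<dots> = 1" using p dr by (simp add: coeff_eq_0)
  finally show "p div q = [:coeff (p div q) 0, 1:]"
    using dd by (intro poly_eqI) (auto simp: coeff_pCons coeff_eq_0 split: nat.split)
qed

lemma euclid_seq_Suc:
  "euclid_seq p q (Suc k) =
     euclid_seq q (smult (inverse (lead_coeff (p mod q))) (p mod q)) k"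
  by (induction k rule: induct_nat_012) (simp_all only: euclid_seq.simps Let_def)

lemma euclid_Suc:
  assumes "n \<le> N + 1"
  shows "euclid_poly (Suc N) p q n =
     euclid_poly N q (smult (inverse (lead_coeff (p mod q))) (p mod q)) n"
  using assms by (simp add: euclid_poly_def Suc_diff_le euclid_seq_Suc del: euclid_seq.simps)

proposition euclid_existence:
  assumes "interlacing_pair N p q"
  shows "euclid_poly N p q (N + 1) = p" "euclid_poly N p q N = q"
    "euclid_poly N p q 0 = 1" "euclid_poly N p q 1 = [:- euclid_b N p q 0, 1:]"
    "\<And>n. n \<le> N + 1 \<Longrightarrow> degree (euclid_poly N p q n) = n \<and> lead_coeff (euclid_poly N p q n) = 1"
    "\<And>n. 1 \<le> n \<Longrightarrow> n \<le> N \<Longrightarrow> euclid_u N p q n > 0"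
    "\<And>n. 1 \<le> n \<Longrightarrow> n \<le> N \<Longrightarrow> euclid_poly N p q (n + 1) =
       [:- euclid_b N p q n, 1:] * euclid_poly N p q n
       - smult (euclid_u N p q n) (euclid_poly N p q (n - 1))"
proof -
  show "euclid_poly N p q (N + 1) = p" "euclid_poly N p q N = q"
    by (simp_all add: euclid_poly_def)
  have "(\<forall>n\<le>N + 1. degree (euclid_poly N p q n) = n \<and> lead_coeff (euclid_poly N p q n) = 1) \<and>
    (\<forall>n. 1 \<le> n \<and> n \<le> N \<longrightarrow> euclid_u N p q n > 0 \<and> euclid_poly N p q (n + 1) =
       [:- euclid_b N p q n, 1:] * euclid_poly N p q n
       - smult (euclid_u N p q n) (euclid_poly N p q (n - 1)))"
    using assms
  proof (induction N arbitrary: p q)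
    case 0
    then show ?case
      by (auto simp: interlacing_pair_def euclid_poly_def le_Suc_eq)
  next
    case (Suc N)
    define r where "r = p mod q"
    define s where "s = smult (inverse (lead_coeff r)) r"
    note st = interlacing_step[OF Suc.prems, folded r_def, folded s_def]
    note IH = Suc.IH[OF st(1)]
    have P: "euclid_poly (Suc N) p q n = euclid_poly N q s n" if "n \<le> N + 1" for n
      using euclid_Suc[OF that] by (simp add: r_def s_def)
    have Ptop: "euclid_poly (Suc N) p q (Suc (Suc N)) = p" "euclid_poly (Suc N) p q (Suc N) = q"
      "euclid_poly (Suc N) p q N = s"
      by (simp_all add: euclid_poly_def r_def s_def numeral_2_eq_2 Let_def)
    have "degree p = Suc (Suc N)" "lead_coeff p = 1"
      using Suc.prems by (auto simp: interlacing_pair_def)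
    then have D: "\<forall>n\<le>Suc N + 1. degree (euclid_poly (Suc N) p q n) = n \<and>
        lead_coeff (euclid_poly (Suc N) p q n) = 1"
      using IH P Ptop by (auto simp: le_Suc_eq)
    have R: "euclid_u (Suc N) p q n > 0 \<and> euclid_poly (Suc N) p q (n + 1) =
       [:- euclid_b (Suc N) p q n, 1:] * euclid_poly (Suc N) p q n
       - smult (euclid_u (Suc N) p q n) (euclid_poly (Suc N) p q (n - 1))"
      if n: "1 \<le> n" "n \<le> Suc N" for n
    proof (cases "n = Suc N")
      case False
      with n have "n \<le> N" by simp
      then show ?thesis using IH n P by (simp add: euclid_u_def euclid_b_def)
    next
      case True
      have u: "euclid_u (Suc N) p q n = - lead_coeff r"
        by (simp add: euclid_u_def True Ptop r_def)
      have b: "[:- euclid_b (Suc N) p q n, 1:] = p div q"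
        using st(3) by (simp add: euclid_b_def True Ptop)
      have "p = p div q * q + r" by (simp add: r_def)
      moreover have "smult (lead_coeff r) s = r"
      proof -
        have "lead_coeff r * inverse (lead_coeff r) = 1" using st(2) by (intro right_inverse) auto
        then show ?thesis unfolding s_def smult_smult by (simp only: smult_1_left)
      qed
      ultimately show ?thesis unfolding u b using True st(2) by (simp add: Ptop)
    qed
    show ?case using D R by blast
  qed
  note * = this
  then show D: "\<And>n. n \<le> N + 1 \<Longrightarrow>
      degree (euclid_poly N p q n) = n \<and> lead_coeff (euclid_poly N p q n) = 1"
    and "\<And>n. 1 \<le> n \<Longrightarrow> n \<le> N \<Longrightarrow> euclid_u N p q n > 0"
    and "\<And>n. 1 \<le> n \<Longrightarrow> n \<le> N \<Longrightarrow> euclid_poly N p q (n + 1) =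
       [:- euclid_b N p q n, 1:] * euclid_poly N p q n
       - smult (euclid_u N p q n) (euclid_poly N p q (n - 1))"
    by blast+
  show one: "euclid_poly N p q 0 = 1"
    using D[of 0] by (auto elim!: degree_eq_zeroE)
  have "euclid_poly N p q 1 = [:coeff (euclid_poly N p q 1) 0, 1:]"
    using D[of 1] by (intro poly_eqI) (auto simp: coeff_pCons coeff_eq_0 split: nat.split)
  then show "euclid_poly N p q 1 = [:- euclid_b N p q 0, 1:]"
    by (simp add: euclid_b_def one)
qed

proposition sturmian_interlacing:
  assumes "degree p = N + 1" "lead_coeff p = 1"
    and "strict_mono_on {..N} x" "\<forall>s\<le>N. order (x s) p = 1"
  shows "interlacing_pair N p (smult (1 / real (N + 1)) (pderiv p))"
proof -
  have p0: "p \<noteq> 0" using assms(1) by auto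
  have root: "\<forall>s\<le>N. poly p (x s) = 0" using assms(4) p0 by (auto simp: order_root)
  have "\<exists>z>x s. z < x (Suc s) \<and> poly (pderiv p) z = 0" if "s < N" for s
  proof -
    have "x s < x (Suc s)" using assms(3) that by (auto simp: strict_mono_on_def)
    then show ?thesis using poly_MVT[of "x s" "x (Suc s)" p] root that by auto
  qed
  then obtain y where y: "\<And>s. s < N \<Longrightarrow> x s < y s \<and> y s < x (Suc s) \<and> poly (pderiv p) (y s) = 0"
    by metis
  have "coeff (pderiv p) N = real (N + 1)" using assms(1,2) by (simp add: coeff_pderiv)
  then show ?thesis
    unfolding interlacing_pair_def using assms(1,2) root y
    by (intro conjI exI[of _ x] exI[of _ y]) (auto simp: degree_pderiv)
qed

proposition euclid_uniqueness:
  fixes P :: "nat \<Rightarrow> real poly" and b u :: "nat \<Rightarrow> real"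
  assumes deg: "\<And>n. n \<le> N + 1 \<Longrightarrow> degree (P n) = n"
    and monic: "\<And>n. n \<le> N + 1 \<Longrightarrow> lead_coeff (P n) = 1"
    and P1: "P 1 = [:- b 0, 1:]"
    and u: "\<And>n. 1 \<le> n \<Longrightarrow> n \<le> N \<Longrightarrow> u n > 0"
    and rec: "\<And>n. 1 \<le> n \<Longrightarrow> n \<le> N \<Longrightarrow>
       P (n + 1) = [:- b n, 1:] * P n - smult (u n) (P (n - 1))"
  shows "\<And>n. n \<le> N + 1 \<Longrightarrow> P n = euclid_poly N (P (N + 1)) (P N) n"
    "\<And>n. n \<le> N \<Longrightarrow> b n = euclid_b N (P (N + 1)) (P N) n"
    "\<And>n. 1 \<le> n \<Longrightarrow> n \<le> N \<Longrightarrow> u n = euclid_u N (P (N + 1)) (P N) n"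
proof -
  have dm: "P (n + 1) div P n = [:- b n, 1:] \<and> P (n + 1) mod P n = smult (- u n) (P (n - 1))"
    if n: "1 \<le> n" "n \<le> N" for n
  proof -
    have "P n \<noteq> 0" using deg[of n] n by auto
    moreover have "degree (smult (- u n) (P (n - 1))) < degree (P n)"
      using n deg[of n] deg[of "n - 1"] by simp
    moreover have "P (n + 1) = smult (- u n) (P (n - 1)) + [:- b n, 1:] * P n"
      using rec[OF n] by simp
    ultimately show ?thesis
      by (metis div_mult_self1 mod_mult_self1 div_poly_less mod_poly_less add_0_right)
  qed
  have lc: "lead_coeff (P (n + 1) mod P n) = - u n" if n: "1 \<le> n" "n \<le> N" for n
    using dm[OF n] monic[of "n - 1"] n by (simp add: lead_coeff_smult)
  have E: "P (N + 1 - k) = euclid_seq (P (N + 1)) (P N) k" if "k \<le> N + 1" for k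
    using that
  proof (induction k rule: induct_nat_012)
    case (ge2 k)
    define n where "n = N - k"
    have n: "1 \<le> n" "n \<le> N" using ge2 by (auto simp: n_def)
    have i: "N + 1 - k = n + 1" "N + 1 - Suc k = n" "N + 1 - Suc (Suc k) = n - 1"
      using ge2 by (auto simp: n_def)
    have 1: "euclid_seq (P (N + 1)) (P N) k = P (n + 1)"
      "euclid_seq (P (N + 1)) (P N) (Suc k) = P n"
      using ge2 i by simp_all
    have "euclid_seq (P (N + 1)) (P N) (Suc (Suc k)) = smult (inverse (- u n)) (P (n + 1) mod P n)"
      by (simp only: euclid_seq.simps 1 Let_def lc[OF n])
    also have "\<dots> = P (n - 1)" using dm[OF n] u[OF n] by simp
    finally show ?case by (simp only: i)
  qed simp_all
  show P: "P n = euclid_poly N (P (N + 1)) (P N) n" if "n \<le> N + 1" for n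
    using E[of "N + 1 - n"] that by (simp add: euclid_poly_def)
  show "u n = euclid_u N (P (N + 1)) (P N) n" if "1 \<le> n" "n \<le> N" for n
    using lc[OF that] P[of "n + 1"] P[of n] that by (simp add: euclid_u_def)
  show "b n = euclid_b N (P (N + 1)) (P N) n" if "n \<le> N" for n
  proof (cases "n = 0")
    case True
    have "P 0 = 1" using deg[of 0] monic[of 0] by (auto elim!: degree_eq_zeroE)
    then show ?thesis using P[of 1] P[of 0] P1 True by (simp add: euclid_b_def)
  next
    case False
    then show ?thesis using dm[of n] P[of "n + 1"] P[of n] that by (simp add: euclid_b_def)
  qed
qed

end

theory Submission
  imports Defs
begin

text \<open>
  Let \<open>P\<^sub>n\<close> be the polynomials that the Euclidean algorithm attaches to a pair
  \<open>(p, q) = (P\<^sub>N\<^sub>+\<^sub>1, P\<^sub>N)\<close>. Running the three-term recurrence from the top down, modulo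
  \<open>p\<close>, starts with \<open>1 \<cdot> q\<close> and uses the coefficients \<open>b\<^sub>N, b\<^sub>N\<^sub>-\<^sub>1, \<dots>\<close> and
  \<open>u\<^sub>N, u\<^sub>N\<^sub>-\<^sub>1, \<dots>\<close>, which are exactly those of the mirror-dual recurrence. Hence
  \<open>P\<^sup>*\<^sub>n q = u\<^sup>*\<^sub>1 \<cdots> u\<^sup>*\<^sub>n P\<^sub>N\<^sub>-\<^sub>n\<close> at every zero of \<open>p\<close>
  (\<open>mirror_dual_at_root\<close>).

  For a Sturmian pair the constant weight \<open>1 / (N + 1)\<close> equals \<open>q(x\<^sub>s) / p'(x\<^sub>s)\<close>. So, for
  \<open>m \<le> n\<close>, the inner product of \<open>P\<^sup>*\<^sub>n\<close> and \<open>P\<^sup>*\<^sub>m\<close> is \<open>u\<^sup>*\<^sub>1 \<cdots> u\<^sup>*\<^sub>n\<close> times the sum of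
  \<open>g(x\<^sub>s) / p'(x\<^sub>s)\<close> with \<open>g = P\<^sub>N\<^sub>-\<^sub>n P\<^sup>*\<^sub>m\<close>. As \<open>g\<close> has degree \<open>N - n + m \<le> N\<close>,
  Lagrange interpolation identifies this sum with the coefficient of \<open>g\<close> at degree \<open>N\<close>
  (\<open>sum_over_roots_div_pderiv\<close>): it is \<open>1\<close> for \<open>m = n\<close> and \<open>0\<close> for \<open>m < n\<close>.

  The converse follows because monic orthogonal polynomials on \<open>N + 1\<close> points are determined by
  the weights (\<open>monic_orthogonal_unique\<close>), and the mirror-dual polynomials of the Sturmian pair
  built from the points are orthogonal for constant weights by the first part.
\<close>

section \<open>Sums over the roots of a polynomial\<close>

lemma poly_zero_if_many_roots:
  fixes f :: "real poly" and x :: "'i \<Rightarrow> real"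
  assumes "finite I" "inj_on x I" "degree f < card I" "\<And>s. s \<in> I \<Longrightarrow> poly f (x s) = 0"
  shows "f = 0"
proof (rule ccontr)
  assume "f \<noteq> 0"
  have "card I = card (x ` I)" using assms(2) by (simp add: card_image)
  also have "\<dots> \<le> card {a. poly f a = 0}"
    using assms(4) by (intro card_mono poly_roots_finite \<open>f \<noteq> 0\<close>) auto
  also have "\<dots> \<le> degree f" using \<open>f \<noteq> 0\<close> by (rule card_poly_roots_bound)
  finally show False using assms(3) by simp
qed

lemma pderiv_linear_factor_at_root:
  fixes f :: "'a::idom poly"
  shows "poly (pderiv ([:- a, 1:] * f)) a = poly f a"
  by (subst pderiv_mult) (simp add: pderiv_pCons)

text \<open>
  The Lagrange interpolation formula for \<open>g\<close> at the roots of \<open>p\<close> reads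
  \<open>g = \<Sum>\<^sub>s g(x\<^sub>s) / p'(x\<^sub>s) \<cdot> l\<^sub>s\<close> with the monic polynomials \<open>l\<^sub>s = p / (X - x\<^sub>s)\<close>; compare the
  coefficients of highest degree.
\<close>

lemma sum_over_roots_div_pderiv:
  fixes g :: "real poly" and x :: "'i \<Rightarrow> real"
  assumes I: "finite I" "card I = Suc N" and inj: "inj_on x I" and g: "degree g \<le> N"
  defines "p \<equiv> \<Prod>s\<in>I. [:- x s, 1:]"
  shows "(\<Sum>s\<in>I. poly g (x s) / poly (pderiv p) (x s)) = coeff g N"
proof -
  define l where "l s = (\<Prod>t\<in>I - {s}. [:- x t, 1:])" for s
  have deg: "degree (l s) = N" if "s \<in> I" for s
    unfolding l_def using that I by (subst degree_prod_eq_sum_degree) auto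
  have "lead_coeff (l s) = 1" for s by (simp add: l_def lead_coeff_prod)
  then have top: "coeff (l s) N = 1" if "s \<in> I" for s using deg[OF that] by metis
  have off: "poly (l s) (x r) = 0" if "r \<in> I" "r \<noteq> s" for r s
    unfolding l_def poly_prod using that I by (intro prod_zero) auto
  have diag: "poly (l s) (x s) \<noteq> 0" if "s \<in> I" for s
    unfolding l_def poly_prod using that I inj by (auto simp: inj_on_def)
  have "p = [:- x s, 1:] * l s" if "s \<in> I" for s
    unfolding p_def l_def using that I by (subst prod.remove[of I s]) auto
  then have pd: "poly (pderiv p) (x s) = poly (l s) (x s)" if "s \<in> I" for s
    using that by (metis pderiv_linear_factor_at_root)
  define c where "c s = poly g (x s) / poly (pderiv p) (x s)" for s
  have "g - (\<Sum>s\<in>I. smult (c s) (l s)) = 0"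
  proof (rule poly_zero_if_many_roots[OF I(1) inj])
    have "degree (\<Sum>s\<in>I. smult (c s) (l s)) \<le> N"
      using deg by (intro degree_sum_le I(1)) (auto intro: order.trans[OF degree_smult_le])
    then show "degree (g - (\<Sum>s\<in>I. smult (c s) (l s))) < card I"
      using g I(2) degree_diff_le[of g N] by (simp add: less_Suc_eq_le)
    fix r assume r: "r \<in> I"
    have "(\<Sum>s\<in>I. c s * poly (l s) (x r)) = (\<Sum>s\<in>I. if s = r then c r * poly (l r) (x r) else 0)"
      using off[OF r] by (intro sum.cong) auto
    also have "\<dots> = c r * poly (l r) (x r)" using I(1) r by simp
    finally show "poly (g - (\<Sum>s\<in>I. smult (c s) (l s))) (x r) = 0"
      using diag[OF r] pd[OF r] by (simp add: poly_sum c_def)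
  qed
  then have "g = (\<Sum>s\<in>I. smult (c s) (l s))" by simp
  from arg_cong[OF this, of "\<lambda>f. coeff f N"]
  have "coeff g N = (\<Sum>s\<in>I. c s * coeff (l s) N)" by (simp add: coeff_sum)
  then show ?thesis using top by (simp add: c_def)
qed

section \<open>Monic orthogonal polynomials on finitely many points\<close>

text \<open>
  Monic polynomials of degrees \<open>0, \<dots>, n - 1\<close> span all polynomials of degree below \<open>n\<close>. Bounding
  the degree of \<open>f\<close> through its coefficients covers \<open>f = 0\<close> when \<open>n = 0\<close>.
\<close>

lemma orthogonal_to_lower_degree:
  fixes Q :: "nat \<Rightarrow> real poly" and x v :: "'i \<Rightarrow> real"
  assumes "\<And>m. m < n \<Longrightarrow> degree (Q m) = m \<and> lead_coeff (Q m) = 1"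
    and "\<And>m. m < n \<Longrightarrow> (\<Sum>s\<in>I. poly (Q m) (x s) * v s) = 0"
    and "\<And>i. n \<le> i \<Longrightarrow> coeff f i = 0"
  shows "(\<Sum>s\<in>I. poly f (x s) * v s) = 0"
  using assms
proof (induction n arbitrary: f)
  case 0
  then have "f = 0" by (intro poly_eqI) simp
  then show ?case by simp
next
  case (Suc n)
  define f' where "f' = f - smult (coeff f n) (Q n)"
  have Qn: "degree (Q n) = n" "coeff (Q n) n = 1" using Suc.prems(1)[of n] by auto
  have low: "coeff f' i = 0" if "n \<le> i" for i
    using that Qn Suc.prems(3)[of i] by (cases "i = n") (auto simp: f'_def coeff_eq_0)
  have "(\<Sum>s\<in>I. poly f' (x s) * v s) = 0"
    by (rule Suc.IH[OF Suc.prems(1)[OF less_SucI] Suc.prems(2)[OF less_SucI] low])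
  moreover have "(\<Sum>s\<in>I. poly f (x s) * v s) =
      (\<Sum>s\<in>I. poly f' (x s) * v s) + coeff f n * (\<Sum>s\<in>I. poly (Q n) (x s) * v s)"
    unfolding sum_distrib_left sum.distrib[symmetric]
    by (intro sum.cong) (auto simp: f'_def algebra_simps)
  ultimately show ?case using Suc.prems(2)[of n] by simp
qed

text \<open>
  The difference of the two candidates of degree \<open>n\<close> has smaller degree, so it is orthogonal to
  both of them and therefore to itself. It vanishes on more points than its degree.
\<close>

lemma monic_orthogonal_unique:
  fixes Q R :: "nat \<Rightarrow> real poly" and x :: "'i \<Rightarrow> real"
  assumes I: "finite I" "inj_on x I" and n: "n < card I"
    and Q: "\<And>m. m \<le> n \<Longrightarrow> degree (Q m) = m \<and> lead_coeff (Q m) = 1"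
    and R: "\<And>m. m \<le> n \<Longrightarrow> degree (R m) = m \<and> lead_coeff (R m) = 1"
    and oQ: "\<And>m. m < n \<Longrightarrow> (\<Sum>s\<in>I. poly (Q m) (x s) * poly (Q n) (x s)) = 0"
    and oR: "\<And>m. m < n \<Longrightarrow> (\<Sum>s\<in>I. poly (R m) (x s) * poly (R n) (x s)) = 0"
  shows "Q n = R n"
proof -
  define d where "d = Q n - R n"
  have d: "coeff d i = 0" if "n \<le> i" for i
    using that Q[of n] R[of n] by (cases "i = n") (auto simp: d_def coeff_eq_0)
  have "(\<Sum>s\<in>I. poly d (x s) * poly (Q n) (x s)) = 0"
    by (rule orthogonal_to_lower_degree[OF Q[OF less_imp_le] oQ d])
  moreover have "(\<Sum>s\<in>I. poly d (x s) * poly (R n) (x s)) = 0"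
    by (rule orthogonal_to_lower_degree[OF R[OF less_imp_le] oR d])
  ultimately have "(\<Sum>s\<in>I. (poly d (x s))\<^sup>2) = 0"
    unfolding power2_eq_square by (subst (2) d_def) (simp add: right_diff_distrib sum_subtractf)
  then have "\<forall>s\<in>I. poly d (x s) = 0"
    using I(1) by (simp add: sum_nonneg_eq_0_iff)
  moreover have "degree d < card I"
    using d n by (intro le_less_trans[OF degree_le[of n d]]) auto
  ultimately have "d = 0" by (intro poly_zero_if_many_roots[OF I]) auto
  then show ?thesis by (simp add: d_def)
qed

section \<open>Mirror-dual polynomials\<close>

lemma three_term_monic:
  "degree (three_term b u n) = n \<and> lead_coeff (three_term b u n) = 1"
proof (induction n rule: induct_nat_012)
  case (ge2 n)
  let ?A = "[:- b (Suc n), 1:] * three_term b u (Suc n)"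
  let ?B = "smult (u (Suc n)) (three_term b u n)"
  have "three_term b u (Suc n) \<noteq> 0" using ge2 by auto
  then have A: "degree ?A = Suc (Suc n)" using ge2 by (subst degree_mult_eq) auto
  have "lead_coeff ?A = 1" using ge2 by (subst lead_coeff_mult) auto
  moreover have "degree ?B < degree ?A"
    unfolding A using ge2 degree_smult_le[of "u (Suc n)" "three_term b u n"] by linarith
  ultimately have "degree (?A + - ?B) = degree ?A" "lead_coeff (?A + - ?B) = 1"
    using degree_add_eq_left[of "- ?B" ?A] by (auto simp only: degree_minus coeff_add coeff_minus coeff_eq_0)
  then show ?case unfolding A three_term.simps(3) by (simp only: diff_conv_add_uminus A)
qed simp_all

text \<open>
  Solving the Euclidean recurrence at a root of \<open>p\<close> for the polynomial of lowest degree shows that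
  the values \<open>u\<^sup>*\<^sub>1 \<cdots> u\<^sup>*\<^sub>n P\<^sub>N\<^sub>-\<^sub>n\<close> obey the mirror-dual recurrence. Its first step is the one
  where \<open>p\<close> itself enters, and there \<open>p\<close> vanishes.
\<close>

lemma mirror_dual_at_root:
  assumes pq: "interlacing_pair N p q" and root: "poly p a = 0" and "n \<le> N"
  shows "poly (mirror_dual N p q n) a * poly q a =
    (\<Prod>k=1..n. mirror_u N p q k) * poly (euclid_poly N p q (N - n)) a"
  using \<open>n \<le> N\<close>
proof (induction n rule: induct_nat_012)
  case 0
  show ?case using euclid_existence(2)[OF pq] by (simp add: mirror_dual_def)
next
  case 1
  have "euclid_poly N p q (N + 1) = [:- euclid_b N p q N, 1:] * euclid_poly N p q N
       - smult (euclid_u N p q N) (euclid_poly N p q (N - 1))"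
    using 1 by (intro euclid_existence(7)[OF pq]) auto
  from arg_cong[OF this, of "\<lambda>f. poly f a"] show ?case
    using root unfolding euclid_existence(1,2)[OF pq]
    by (simp add: mirror_dual_def mirror_b_def mirror_u_def algebra_simps)
next
  case (ge2 n)
  define k where "k = N - Suc n"
  have k: "N - n = k + 1" "N - Suc n = k" "N - Suc (Suc n) = k - 1" "1 \<le> k" "k \<le> N"
    using ge2.prems by (auto simp: k_def)
  have u: "mirror_u N p q (Suc n) = euclid_u N p q (k + 1)"
    "mirror_u N p q (Suc (Suc n)) = euclid_u N p q k"
    and b: "mirror_b N p q (Suc n) = euclid_b N p q k"
    using k by (simp_all add: mirror_u_def mirror_b_def)
  let ?E = "\<lambda>i. poly (euclid_poly N p q i) a"
  let ?h = "\<lambda>n. \<Prod>k=1..n. mirror_u N p q k"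
  have rec: "?E (k + 1) = (a - euclid_b N p q k) * ?E k - euclid_u N p q k * ?E (k - 1)"
    using arg_cong[OF euclid_existence(7)[OF pq k(4,5)], of "\<lambda>f. poly f a"]
    by (simp add: algebra_simps)
  have "poly (mirror_dual N p q (Suc (Suc n))) a * poly q a =
      (a - euclid_b N p q k) * (poly (mirror_dual N p q (Suc n)) a * poly q a)
      - euclid_u N p q (k + 1) * (poly (mirror_dual N p q n) a * poly q a)"
    by (simp add: mirror_dual_def u b algebra_simps)
  also have "\<dots> = (a - euclid_b N p q k) * (?h (Suc n) * ?E k)
      - euclid_u N p q (k + 1) * (?h n * ?E (k + 1))"
    using ge2 k by simp
  also have "\<dots> = ?h (Suc n) * ((a - euclid_b N p q k) * ?E k - ?E (k + 1))"
    by (simp add: u algebra_simps)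
  also have "\<dots> = ?h (Suc n) * (euclid_u N p q k * ?E (k - 1))"
    by (simp only: rec) (simp add: algebra_simps)
  also have "\<dots> = ?h (Suc (Suc n)) * ?E (N - Suc (Suc n))"
    using k by (simp add: u)
  finally show ?case .
qed

section \<open>Constant weights for Sturmian pairs\<close>

text \<open>
  By \<open>mirror_dual_at_root\<close> the factor \<open>q\<close> in the weight \<open>q(x\<^sub>s) / p'(x\<^sub>s)\<close> lowers
  \<open>P\<^sup>*\<^sub>n\<close> to a multiple of \<open>P\<^sub>N\<^sub>-\<^sub>n\<close>. The order \<open>m \<le> n\<close> keeps the degree of
  the remaining product within the range of \<open>sum_over_roots_div_pderiv\<close>.
\<close>

lemma sturmian_mirror_dual_orthogonal_le:
  fixes p :: "real poly" and x :: "nat \<Rightarrow> real"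
  assumes p: "degree p = N + 1" "lead_coeff p = 1"
    and x: "strict_mono_on {..N} x" "\<forall>s\<le>N. order (x s) p = 1"
  defines "q \<equiv> smult (1 / real (N + 1)) (pderiv p)"
  assumes "m \<le> n" "n \<le> N"
  shows "1 / real (N + 1) *
      (\<Sum>s\<le>N. poly (mirror_dual N p q n) (x s) * poly (mirror_dual N p q m) (x s)) =
    (if n = m then \<Prod>k=1..n. mirror_u N p q k else 0)"
proof -
  let ?h = "\<Prod>k=1..n. mirror_u N p q k"
  define g where "g = euclid_poly N p q (N - n) * mirror_dual N p q m"
  have pq: "interlacing_pair N p q" unfolding q_def using p x by (rule sturmian_interlacing)
  have p0: "p \<noteq> 0" using p by auto
  have root: "poly p (x s) = 0" if "s \<le> N" for s using x(2) p0 that by (auto simp: order_root)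
  have inj: "inj_on x {..N}" using x(1) by (rule strict_mono_on_imp_inj_on)
  have pp: "p = (\<Prod>s\<le>N. [:- x s, 1:])"
    using poly_from_roots(1)[OF p0, of "Suc N" x] p inj root
    by (simp add: lessThan_Suc_atMost less_Suc_eq_le)
  have simple: "poly (pderiv p) (x s) \<noteq> 0" if "s \<le> N" for s
  proof
    assume "poly (pderiv p) (x s) = 0"
    moreover have "pderiv p \<noteq> 0" using p by (simp add: pderiv_eq_0_iff)
    ultimately have "order (x s) (pderiv p) \<noteq> 0" by (simp add: order_root)
    moreover have "order (x s) p = Suc (order (x s) (pderiv p))"
      using root[OF that] p0 \<open>pderiv p \<noteq> 0\<close> by (intro order_pderiv) (auto simp: order_root)
    ultimately show False using x(2) that by simp
  qed
  have E: "degree (euclid_poly N p q (N - n)) = N - n" "lead_coeff (euclid_poly N p q (N - n)) = 1"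
    using euclid_existence(5)[OF pq diff_le_self[THEN le_trans[OF _ le_add1]]] by blast+
  have M: "degree (mirror_dual N p q m) = m" "lead_coeff (mirror_dual N p q m) = 1"
    unfolding mirror_dual_def using three_term_monic by blast+
  have "euclid_poly N p q (N - n) \<noteq> 0" "mirror_dual N p q m \<noteq> 0" using E M by auto
  then have dg: "degree g = N - n + m" using E M by (simp add: g_def degree_mult_eq)
  have "lead_coeff g = 1" using E M by (simp only: g_def lead_coeff_mult)
  then have top: "coeff g N = (if n = m then 1 else 0)"
    using dg \<open>m \<le> n\<close> \<open>n \<le> N\<close> by (auto simp: coeff_eq_0)
  have weight: "1 / real (N + 1) = poly q (x s) / poly (pderiv p) (x s)" if "s \<le> N" for s
    using simple[OF that] by (simp add: q_def)
  have "1 / real (N + 1) *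
      (\<Sum>s\<le>N. poly (mirror_dual N p q n) (x s) * poly (mirror_dual N p q m) (x s)) =
    (\<Sum>s\<le>N. poly (mirror_dual N p q n) (x s) * poly q (x s) * poly (mirror_dual N p q m) (x s)
      / poly (pderiv p) (x s))"
    unfolding sum_distrib_left
  proof (intro sum.cong refl)
    fix s assume "s \<in> {..N}"
    then have "s \<le> N" by simp
    then show "1 / real (N + 1) *
        (poly (mirror_dual N p q n) (x s) * poly (mirror_dual N p q m) (x s)) =
      poly (mirror_dual N p q n) (x s) * poly q (x s) * poly (mirror_dual N p q m) (x s)
        / poly (pderiv p) (x s)"
      by (subst weight) (simp_all add: mult_ac)
  qed
  also have "\<dots> = (\<Sum>s\<le>N. ?h * (poly g (x s) / poly (pderiv p) (x s)))"
    using mirror_dual_at_root[OF pq root \<open>n \<le> N\<close>] by (intro sum.cong) (auto simp: g_def)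
  also have "\<dots> = ?h * (\<Sum>s\<le>N. poly g (x s) / poly (pderiv p) (x s))"
    by (simp only: sum_distrib_left)
  also have "\<dots> = ?h * coeff g N"
    using sum_over_roots_div_pderiv[of "{..N}" N x g] inj dg \<open>m \<le> n\<close> \<open>n \<le> N\<close>
    by (simp flip: pp)
  finally show ?thesis by (simp add: top)
qed

lemma sturmian_mirror_dual_orthogonal:
  fixes p :: "real poly" and x :: "nat \<Rightarrow> real"
  assumes p: "degree p = N + 1" "lead_coeff p = 1"
    and x: "strict_mono_on {..N} x" "\<forall>s\<le>N. order (x s) p = 1"
  defines "q \<equiv> smult (1 / real (N + 1)) (pderiv p)"
  assumes "n \<le> N" "m \<le> N"
  shows "1 / real (N + 1) *
      (\<Sum>s\<le>N. poly (mirror_dual N p q n) (x s) * poly (mirror_dual N p q m) (x s)) =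
    (if n = m then \<Prod>k=1..n. mirror_u N p q k else 0)"
proof (cases "m \<le> n")
  case True
  then show ?thesis
    unfolding q_def using p x \<open>n \<le> N\<close> by (intro sturmian_mirror_dual_orthogonal_le)
next
  case False
  then have "n \<le> m" "n \<noteq> m" by auto
  then show ?thesis
    using sturmian_mirror_dual_orthogonal_le[OF p x \<open>n \<le> m\<close> \<open>m \<le> N\<close>, folded q_def]
    by (simp add: mult.commute)
qed

lemma order_prod_linear_factors:
  fixes x :: "'i \<Rightarrow> real"
  assumes "finite I" "inj_on x I" "s \<in> I"
  shows "order (x s) (\<Prod>t\<in>I. [:- x t, 1:]) = 1"
proof -
  have "poly (\<Prod>t\<in>I - {s}. [:- x t, 1:]) (x s) \<noteq> 0"
    using assms by (auto simp: poly_prod inj_on_def)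
  then have "order (x s) (\<Prod>t\<in>I - {s}. [:- x t, 1:]) = 0" by (rule order_0I)
  moreover have "order (x s) [:- x s, 1:] = 1" using order_power_n_n[of "x s" 1] by simp
  moreover have "[:- x s, 1:] * (\<Prod>t\<in>I - {s}. [:- x t, 1:]) \<noteq> 0"
    using assms(1) by (subst mult_eq_0_iff) auto
  ultimately have "order (x s) ([:- x s, 1:] * (\<Prod>t\<in>I - {s}. [:- x t, 1:])) = 1"
    by (subst order_mult) auto
  then show ?thesis using assms by (subst prod.remove[of I s]) auto
qed

theorem proposition1:
  fixes N :: nat
  assumes "N \<ge> 1"
  shows
    "(\<forall>(p :: real poly) (x :: nat \<Rightarrow> real).
        degree p = N + 1 \<and> lead_coeff p = 1 \<and>
        strict_mono_on {..N} x \<and> (\<forall>s\<le>N. order (x s) p = 1) \<longrightarrow>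
        (let q = smult (1 / real (N + 1)) (pderiv p) in
          \<forall>n\<le>N. \<forall>m\<le>N.
            1 / real (N + 1) *
              (\<Sum>s\<le>N. poly (mirror_dual N p q n) (x s) * poly (mirror_dual N p q m) (x s))
            = (if n = m then \<Prod>k=1..n. mirror_u N p q k else 0)))
     \<and>
     (\<forall>(x :: nat \<Rightarrow> real) (Q :: nat \<Rightarrow> real poly).
        strict_mono_on {..N} x \<and>
        (\<forall>n\<le>N. degree (Q n) = n \<and> lead_coeff (Q n) = 1) \<and>
        (\<forall>n\<le>N. \<forall>m\<le>N. n \<noteq> m \<longrightarrow>
            (\<Sum>s\<le>N. 1 / real (N + 1) * (poly (Q n) (x s) * poly (Q m) (x s))) = 0) \<longrightarrow>
        (let p = (\<Prod>s\<le>N. [:- x s, 1:]); q = smult (1 / real (N + 1)) (pderiv p) in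
          \<forall>n\<le>N. Q n = mirror_dual N p q n))"
proof (intro conjI allI impI, goal_cases)
  case (1 p x)
  then show ?case
    unfolding Let_def by (intro allI impI sturmian_mirror_dual_orthogonal) auto
next
  case (2 x Q)
  define p where "p = (\<Prod>s\<le>N. [:- x s, 1:])"
  define q where "q = smult (1 / real (N + 1)) (pderiv p)"
  have x: "strict_mono_on {..N} x"
    and Q: "\<And>n. n \<le> N \<Longrightarrow> degree (Q n) = n \<and> lead_coeff (Q n) = 1"
    and oQ: "\<And>n m. n \<le> N \<Longrightarrow> m \<le> N \<Longrightarrow> n \<noteq> m \<Longrightarrow>
      (\<Sum>s\<le>N. 1 / real (N + 1) * (poly (Q n) (x s) * poly (Q m) (x s))) = 0"
    using 2 by blast+
  have inj: "inj_on x {..N}" using x by (rule strict_mono_on_imp_inj_on)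
  have p: "degree p = N + 1" "lead_coeff p = 1"
    unfolding p_def by (subst degree_prod_eq_sum_degree) (auto simp: lead_coeff_prod)
  have ord: "\<forall>s\<le>N. order (x s) p = 1"
    unfolding p_def using inj order_prod_linear_factors[of "{..N}" x] by blast
  have "Q n = mirror_dual N p q n" if n: "n \<le> N" for n
  proof (rule monic_orthogonal_unique[of "{..N}" x])
    show "(\<Sum>s\<le>N. poly (Q m) (x s) * poly (Q n) (x s)) = 0" if "m < n" for m
      using oQ[of m n] that n unfolding sum_distrib_left[symmetric] by simp
    show "(\<Sum>s\<le>N. poly (mirror_dual N p q m) (x s) * poly (mirror_dual N p q n) (x s)) = 0"
      if "m < n" for m
      using sturmian_mirror_dual_orthogonal[OF p x ord, of m n, folded q_def] that n by simp
    show "degree (Q m) = m \<and> lead_coeff (Q m) = 1" if "m \<le> n" for m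
      using Q that n by (metis le_trans)
    show "degree (mirror_dual N p q m) = m \<and> lead_coeff (mirror_dual N p q m) = 1" for m
      unfolding mirror_dual_def by (rule three_term_monic)
  qed (use n inj in auto)
  then show ?case by (simp add: p_def q_def Let_def)
qed

end
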